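(* Let $n\ge2$, $k>0$, and let $\lambda_1,\dots,\lambda_n>0$ be pairwise distinct. Let $Z\sim MHF(k,\lambda_1,\dots,\lambda_n)$, let $Y_i\sim\mathrm{Frechet}(k,\lambda_i)$, and put $PF_i=\prod_{j=1,\,j\ne i}^n\left(1-\left(\frac{\lambda_i}{\lambda_j}\right)^k\right)$. Then, for $t>0$, the cumulative distribution function of $Z$ is $$F_Z(t)=\sum_{i=1}^n\frac{1}{PF_i}F_{Y_i}(t)=\sum_{i=1}^n\frac{e^{-\left(\frac{t}{\lambda_i}\right)^{-k}}}{\prod_{j=1,\,j\neq i}^n\left(1-\left(\frac{\lambda_i}{\lambda_j}\right)^k\right)}.$$
   Context: $\mathrm{Frechet}(k,\lambda)$ with shape $k>0$ and scale $\lambda>0$ has density $\frac{k}{\lambda}\left(\frac{t}{\lambda}\right)^{-1-k}e^{-(t/\lambda)^{-k}}$ for $t>0$. The Mixed Hypoexponential Frechet distribution $MHF(k,\lambda_1,\dots,\lambda_n)$ is the distribution with density $f_Z(t)=\sum_{i=1}^n\frac{1}{PF_i}f_{Y_i}(t)$. $F_X$ denotes the cumulative distribution function of $X$. *)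

theory Defs
  imports "HOL-Probability.Probability"
begin

definition frechet_density :: "real \<Rightarrow> real \<Rightarrow> real \<Rightarrow> real" where
  "frechet_density k l t =
     (if t > 0 then k / l * (t / l) powr (- 1 - k) * exp (- ((t / l) powr (- k))) else 0)"

definition PF :: "real \<Rightarrow> (nat \<Rightarrow> real) \<Rightarrow> nat \<Rightarrow> nat \<Rightarrow> real" where
  "PF k lam n i = (\<Prod>j\<in>{1..n} - {i}. 1 - (lam i / lam j) powr k)"

(* Although some of the weights 1 / PF are negative, this function is nonnegative for
   k > 0 and pairwise distinct positive scales: it is the density of S powr (-1/k)
   with S a sum of independent exponentials of rates (lam i) powr k.  Hence
   coercing it to ennreal, as in "distributed", does not truncate anything. *)
definition mhf_density :: "real \<Rightarrow> (nat \<Rightarrow> real) \<Rightarrow> nat \<Rightarrow> real \<Rightarrow> real" where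
  "mhf_density k lam n t = (\<Sum>i = 1..n. 1 / PF k lam n i * frechet_density k (lam i) t)"

end

theory Submission
  imports Defs "HOL-Real_Asymp.Real_Asymp"
begin

text \<open>
  The weights \<open>1 / PF k lam n i\<close> are the values at \<open>0\<close> of the Lagrange basis polynomials for the
  nodes \<open>lam i powr k\<close>, so they add up to \<open>1\<close> and \<^term>\<open>mhf_density k lam n\<close> has integral \<open>1\<close>.
  Its positive part, which is what \<^term>\<open>ennreal\<close> retains, has integral \<open>1\<close> as well because it
  is the density of a probability measure. Hence the negative part vanishes almost everywhere, and
  the distribution function is the weighted sum of the distribution functions of the components.
\<close>

text \<open>Both sides are polynomials in \<open>x\<close> of degree below \<open>card I\<close>
  that take the value 1 at each of the \<open>card I\<close> distinct nodes, so they are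
  equal.\<close>

lemma sum_Lagrange_basis_eq_1:
  fixes a :: "'i \<Rightarrow> 'a :: field" and x :: 'a
  assumes "finite I" "I \<noteq> {}" "inj_on a I"
  shows "(\<Sum>i\<in>I. \<Prod>j\<in>I - {i}. (x - a j) / (a i - a j)) = 1"
proof -
  define q where
    "q i = smult (1 / (\<Prod>j\<in>I - {i}. a i - a j)) (\<Prod>j\<in>I - {i}. [:- a j, 1:])" for i
  have q: "poly (q i) y = (\<Prod>j\<in>I - {i}. (y - a j) / (a i - a j))" for i y
    by (simp add: q_def poly_prod prod_dividef)
  have deg: "degree (q i) < card I" if "i \<in> I" for i
  proof -
    have "degree (q i) \<le> degree (\<Prod>j\<in>I - {i}. [:- a j, 1:])"
      unfolding q_def by (rule degree_smult_le)
    also have "\<dots> = card (I - {i})"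
      by (subst degree_prod_sum_eq) auto
    also have "\<dots> < card I"
      using assms that by (intro psubset_card_mono) auto
    finally show ?thesis .
  qed
  have pos: "card I > 0"
    using assms by (simp add: card_gt_0_iff)
  have "sum q I = 1"
  proof (rule poly_eqI_degree[where A = "a ` I"])
    fix y assume "y \<in> a ` I"
    then obtain m where m: "m \<in> I" "y = a m" by auto
    \<comment> \<open>At the node \<open>a m\<close> only the basis polynomial with index
      \<open>m\<close> survives: any other contains the factor \<open>j = m\<close>, which vanishes
      there.\<close>
    have "(\<Prod>j\<in>I - {i}. (a m - a j) / (a i - a j)) = (if i = m then 1 else 0)"
      if "i \<in> I" for i
    proof (cases "i = m")
      case True
      have "a m - a j \<noteq> 0" if "j \<in> I - {m}" for j
        using that m assms(3) by (auto simp: inj_on_eq_iff)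
      then show ?thesis
        unfolding True by simp
    next
      case False
      then have "\<exists>j\<in>I - {i}. (a m - a j) / (a i - a j) = 0"
        using m by (intro bexI[of _ m]) auto
      then show ?thesis
        using False assms(1) by (simp add: prod_zero)
    qed
    then have "poly (sum q I) y = (\<Sum>i\<in>I. if i = m then 1 else 0)"
      using m by (simp add: poly_sum q)
    also have "\<dots> = 1"
      using m assms(1) by simp
    finally show "poly (sum q I) y = poly 1 y" by simp
  qed (use assms pos deg in \<open>auto simp: card_image intro: degree_sum_less\<close>)
  then have "poly (sum q I) x = 1" by simp
  then show ?thesis by (simp add: poly_sum q)
qed

lemma sum_inverse_PF_eq_1:
  assumes "n \<ge> 1" "k > 0" "\<And>i. i \<in> {1..n} \<Longrightarrow> lam i > 0" "inj_on lam {1..n}"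
  shows "(\<Sum>i = 1..n. 1 / PF k lam n i) = 1"
proof -
  have eq_iff: "lam i powr k = lam j powr k \<longleftrightarrow> i = j" if "i \<in> {1..n}" "j \<in> {1..n}" for i j
  proof
    assume "lam i powr k = lam j powr k"
    then have "lam i = lam j"
      using assms(2) assms(3)[OF that(1)] assms(3)[OF that(2)]
      by (metis less_imp_le linorder_neqE_linordered_idom order_less_irrefl powr_less_mono2)
    then show "i = j"
      using that assms(4) by (simp add: inj_on_eq_iff)
  qed simp
  then have inj: "inj_on (\<lambda>i. lam i powr k) {1..n}"
    by (auto intro: inj_onI)
  have "1 / PF k lam n i
      = (\<Prod>j\<in>{1..n} - {i}. (0 - lam j powr k) / (lam i powr k - lam j powr k))"
    if i: "i \<in> {1..n}" for i
  proof -
    \<comment> \<open>Numerator and denominator are multiplied by \<open>- (lam j powr k)\<close>.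
      This exhibits the factor as a Lagrange factor evaluated at \<open>x = 0\<close>.\<close>
    have "1 / (1 - (lam i / lam j) powr k) = (0 - lam j powr k) / (lam i powr k - lam j powr k)"
      if j: "j \<in> {1..n} - {i}" for j
    proof -
      have "lam i > 0" "lam j > 0" "lam i powr k \<noteq> lam j powr k"
        using i j assms(3) eq_iff[of i j] by auto
      then show ?thesis
        by (simp add: powr_divide divide_simps) (simp add: algebra_simps)
    qed
    then have "(\<Prod>j\<in>{1..n} - {i}. 1 / (1 - (lam i / lam j) powr k))
        = (\<Prod>j\<in>{1..n} - {i}. (0 - lam j powr k) / (lam i powr k - lam j powr k))"
      by (rule prod.cong[OF refl])
    then show ?thesis
      by (simp add: PF_def prod_dividef)
  qed
  then show ?thesis
    using sum_Lagrange_basis_eq_1[of "{1..n}" "\<lambda>i. lam i powr k" 0] assms(1) inj by simp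
qed

lemma cdf_distributed_ennreal:
  fixes f :: "real \<Rightarrow> real"
  assumes "prob_space M" and D: "distributed M lborel X (\<lambda>x. ennreal (f x))"
    and f: "integrable lborel f" and f1: "(LINT x|lborel. f x) = 1"
  shows "cdf (distr M borel X) t = (LINT x|lborel. indicator {..t} x * f x)"
proof -
  interpret prob_space M by fact
  have X: "X \<in> measurable M borel"
    using distributed_measurable[OF D] by simp
  have [measurable]: "f \<in> borel_measurable borel"
    using f by auto
  have pos: "integrable lborel (\<lambda>x. max 0 (f x))"
    using f by auto
  have "(\<integral>\<^sup>+ x. ennreal (max 0 (f x)) \<partial>lborel) = (\<integral>\<^sup>+ x. ennreal (f x) * indicator UNIV x \<partial>lborel)"
    by (intro nn_integral_cong) (auto simp: max_def ennreal_neg)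
  also have "\<dots> = 1"
    \<comment> \<open>The integral over \<open>UNIV\<close> is the probability of the whole
      space.\<close>
    by (subst distributed_emeasure[OF D, symmetric]) (auto simp: emeasure_space_1)
  finally have "(LINT x|lborel. max 0 (f x)) = 1"
    by (subst integral_eq_nn_integral) (use pos in auto)
  then have "(LINT x|lborel. max 0 (f x) - f x) = 0"
    using pos f f1 by simp
  then have "AE x in lborel. max 0 (f x) - f x = 0"
    by (subst (asm) integral_nonneg_eq_0_iff_AE) (use pos f in auto)
  then have AE: "AE x in lborel. 0 \<le> f x"
    by eventually_elim auto
  have int: "integrable lborel (\<lambda>x. indicator {..t} x * f x)"
    using integrable_mult_indicator[OF _ f, of "{..t}"] by simp
  have nonneg: "AE x in lborel. 0 \<le> indicator {..t} x * f x"
    using AE by eventually_elim (auto simp: indicator_def)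
  have "emeasure (distr M borel X) {..t} = emeasure M (X -` {..t} \<inter> space M)"
    by (rule emeasure_distr[OF X]) simp
  also have "\<dots> = (\<integral>\<^sup>+ x. ennreal (f x) * indicator {..t} x \<partial>lborel)"
    by (rule distributed_emeasure[OF D]) simp
  also have "\<dots> = (\<integral>\<^sup>+ x. ennreal (indicator {..t} x * f x) \<partial>lborel)"
    by (intro nn_integral_cong) (auto simp: indicator_def)
  also have "\<dots> = ennreal (LINT x|lborel. indicator {..t} x * f x)"
    by (rule nn_integral_eq_integral[OF int nonneg])
  finally show ?thesis
    using integral_nonneg_AE[OF nonneg] by (simp add: cdf_def2 measure_def)
qed

text \<open>The density has the antiderivative \<open>exp (- ((t / l) powr (- k)))\<close>, which
  tends to 0 at 0 from the right, so only the limit \<open>L\<close> at \<open>b\<close> remains. An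
  extended real \<open>b\<close> covers both the total mass (\<open>b\<close> infinite) and the
  distribution function (\<open>b\<close> finite).\<close>

lemma has_bochner_integral_frechet_density_einterval:
  fixes b :: ereal
  assumes "k > 0" "l > 0" "0 < b"
    and L: "(((\<lambda>t. exp (- ((t / l) powr (- k)))) \<circ> real_of_ereal) \<longlongrightarrow> L) (at_left b)"
  shows "has_bochner_integral lborel
    (\<lambda>x. indicator (einterval 0 b) x * frechet_density k l x) L"
proof -
  define F where "F t = exp (- ((t / l) powr (- k)))" for t
  have deriv: "(F has_real_derivative frechet_density k l x) (at x)" if "0 < x" for x
    unfolding F_def frechet_density_def
    using that assms(1,2)
    by (auto intro!: derivative_eq_intros simp: powr_diff powr_minus field_simps)
  have cont: "isCont (frechet_density k l) x" if "0 < x" for x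
  proof -
    have "isCont (\<lambda>t. k / l * (t / l) powr (- 1 - k) * exp (- ((t / l) powr (- k)))) x"
      using that assms(2) by (intro continuous_intros) auto
    \<comment> \<open>The definition by cases agrees with its first branch on the open half-line
      around \<open>x\<close>, so continuity transfers.\<close>
    moreover have "eventually (\<lambda>t. frechet_density k l t
        = k / l * (t / l) powr (- 1 - k) * exp (- ((t / l) powr (- k)))) (nhds x)"
      using eventually_nhds_in_open[of "{0<..}" x] that
      by (auto elim!: eventually_mono simp: frechet_density_def)
    ultimately show ?thesis by (simp add: isCont_cong)
  qed
  have nonneg: "0 \<le> frechet_density k l x" for x
    using assms(1,2) by (auto simp: frechet_density_def)
  have lim0: "((F \<circ> real_of_ereal) \<longlongrightarrow> 0) (at_right 0)"
  proof -
    have "(F \<longlongrightarrow> 0) (at_right 0)"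
      unfolding F_def using assms(1,2) by real_asymp
    then show ?thesis
      by (simp add: zero_ereal_def ereal_tendsto_simps)
  qed
  \<comment> \<open>For a nonnegative derivative, this form of the fundamental theorem yields
    integrability up to the endpoints along with the value.\<close>
  have FTC: "set_integrable lborel (einterval 0 b) (frechet_density k l)"
    "(LBINT x=0..b. frechet_density k l x) = L - 0"
    by (rule interval_integral_FTC_nonneg[OF \<open>0 < b\<close>, of F];
        use deriv cont nonneg lim0 L in \<open>simp add: F_def[abs_def]\<close>)+
  then show ?thesis
    using less_imp_le[OF \<open>0 < b\<close>]
    by (simp add: has_bochner_integral_iff set_integrable_def interval_lebesgue_integral_def
        set_lebesgue_integral_def)
qed

lemma has_bochner_integral_frechet_density:
  assumes "k > 0" "l > 0"
  shows "has_bochner_integral lborel (frechet_density k l) 1"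
proof -
  have "((\<lambda>t. exp (- ((t / l) powr (- k)))) \<longlongrightarrow> 1) at_top"
    using assms by real_asymp
  then have "has_bochner_integral lborel
      (\<lambda>x. indicator (einterval 0 \<infinity>) x * frechet_density k l x) 1"
    using assms
    by (intro has_bochner_integral_frechet_density_einterval) (simp_all add: ereal_tendsto_simps)
  moreover have "(\<lambda>x. indicator (einterval 0 \<infinity>) x * frechet_density k l x) = frechet_density k l"
    by (auto simp: fun_eq_iff indicator_def einterval_iff frechet_density_def)
  ultimately show ?thesis by simp
qed

lemma integral_frechet_density_atMost:
  assumes "k > 0" "l > 0" "t > 0"
  shows "(LINT x|lborel. indicator {..t} x * frechet_density k l x) = exp (- ((t / l) powr (- k)))"
proof -
  have "((\<lambda>t. exp (- ((t / l) powr (- k)))) \<longlongrightarrow> exp (- ((t / l) powr (- k)))) (at_left t)"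
    using assms by (intro tendsto_intros) auto
  then have "has_bochner_integral lborel
      (\<lambda>x. indicator (einterval 0 (ereal t)) x * frechet_density k l x)
      (exp (- ((t / l) powr (- k))))"
    using assms
    by (intro has_bochner_integral_frechet_density_einterval) (simp_all add: ereal_tendsto_simps)
  \<comment> \<open>The two sets differ by the nonpositive reals, where the density is 0 by
    definition, and by the null set consisting of \<open>t\<close>.\<close>
  moreover have "(LINT x|lborel. indicator {..t} x * frechet_density k l x)
      = (LINT x|lborel. indicator (einterval 0 (ereal t)) x * frechet_density k l x)"
  proof (rule integral_cong_AE)
    have [measurable]: "frechet_density k l \<in> borel_measurable borel"
      using has_bochner_integral_frechet_density[OF assms(1,2)] by (auto simp: has_bochner_integral_iff)
    show "(\<lambda>x. indicator {..t} x * frechet_density k l x) \<in> borel_measurable lborel"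
      "(\<lambda>x. indicator (einterval 0 (ereal t)) x * frechet_density k l x) \<in> borel_measurable lborel"
      by measurable
    show "AE x in lborel. indicator {..t} x * frechet_density k l x
        = indicator (einterval 0 (ereal t)) x * frechet_density k l x"
      using AE_lborel_singleton[of t]
      by eventually_elim (auto simp: indicator_def einterval_iff frechet_density_def)
  qed
  ultimately show ?thesis
    by (simp add: has_bochner_integral_integral_eq)
qed

theorem corollary3:
  fixes M :: "'a measure" and N :: "nat \<Rightarrow> 'b measure"
    and Z :: "'a \<Rightarrow> real" and Y :: "nat \<Rightarrow> 'b \<Rightarrow> real"
    and lam :: "nat \<Rightarrow> real" and k t :: real and n :: nat
  assumes "n \<ge> 2" and "k > 0"
    and "\<And>i. i \<in> {1..n} \<Longrightarrow> lam i > 0"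
    and "inj_on lam {1..n}"
    and "prob_space M"
    and "distributed M lborel Z (\<lambda>x. ennreal (mhf_density k lam n x))"
    and "\<And>i. i \<in> {1..n} \<Longrightarrow> prob_space (N i)"
    and "\<And>i. i \<in> {1..n} \<Longrightarrow>
           distributed (N i) lborel (Y i) (\<lambda>x. ennreal (frechet_density k (lam i) x))"
    and "t > 0"
  shows "cdf (distr M borel Z) t = (\<Sum>i = 1..n. 1 / PF k lam n i * cdf (distr (N i) borel (Y i)) t)
    \<and> (\<Sum>i = 1..n. 1 / PF k lam n i * cdf (distr (N i) borel (Y i)) t) =
        (\<Sum>i = 1..n. exp (- ((t / lam i) powr (- k))) /
           (\<Prod>j\<in>{1..n} - {i}. 1 - (lam i / lam j) powr k))"
proof -
  have F: "has_bochner_integral lborel (frechet_density k (lam i)) 1" if "i \<in> {1..n}" for i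
    using has_bochner_integral_frechet_density assms(2,3) that by blast
  have mhf: "mhf_density k lam n = (\<lambda>x. \<Sum>i = 1..n. 1 / PF k lam n i * frechet_density k (lam i) x)"
    by (simp add: fun_eq_iff mhf_density_def)
  \<comment> \<open>Linearity holds whatever the signs of the weights, so the mixture integrates to
    the sum of its weights.\<close>
  have "has_bochner_integral lborel (mhf_density k lam n) (\<Sum>i = 1..n. 1 / PF k lam n i * 1)"
    unfolding mhf using F by (intro has_bochner_integral_sum has_bochner_integral_mult_right) auto
  then have Z: "has_bochner_integral lborel (mhf_density k lam n) 1"
    using sum_inverse_PF_eq_1[of n k lam] assms(1-4) by simp
  have cdf_Y: "cdf (distr (N i) borel (Y i)) t
      = (LINT x|lborel. indicator {..t} x * frechet_density k (lam i) x)" if "i \<in> {1..n}" for i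
    using cdf_distributed_ennreal[OF assms(7,8)[OF that]] F[OF that]
    by (simp add: has_bochner_integral_iff)
  have int: "integrable lborel (\<lambda>x. indicator {..t} x * frechet_density k (lam i) x)"
    if "i \<in> {1..n}" for i
    using integrable_mult_indicator[of "{..t}" lborel "frechet_density k (lam i)"] F[OF that]
    by (simp add: has_bochner_integral_iff)
  have "cdf (distr M borel Z) t = (LINT x|lborel. indicator {..t} x * mhf_density k lam n x)"
    using cdf_distributed_ennreal[OF assms(5,6)] Z by (simp add: has_bochner_integral_iff)
  also have "\<dots> = (LINT x|lborel. (\<Sum>i = 1..n.
      1 / PF k lam n i * (indicator {..t} x * frechet_density k (lam i) x)))"
    by (simp add: mhf_density_def sum_distrib_left mult_ac)
  also have "\<dots> = (\<Sum>i = 1..n. 1 / PF k lam n i * cdf (distr (N i) borel (Y i)) t)"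
    \<comment> \<open>Exchanging sum and integral needs each truncated component to be integrable,
      which is \<open>int\<close>; \<open>cdf_Y\<close> then identifies the integrals.\<close>
    using int by (subst Bochner_Integration.integral_sum) (auto simp: cdf_Y)
  finally have "cdf (distr M borel Z) t
      = (\<Sum>i = 1..n. 1 / PF k lam n i * cdf (distr (N i) borel (Y i)) t)" .
  moreover have "(\<Sum>i = 1..n. 1 / PF k lam n i * cdf (distr (N i) borel (Y i)) t) =
        (\<Sum>i = 1..n. exp (- ((t / lam i) powr (- k))) /
           (\<Prod>j\<in>{1..n} - {i}. 1 - (lam i / lam j) powr k))"
    using assms(2,3,9)
    by (intro sum.cong) (auto simp: cdf_Y integral_frechet_density_atMost PF_def)
  ultimately show ?thesis by blast
qed

end
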